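(* Let $G$ be a graph with $v$ vertices and $e$ edges, and let $n$ be a positive integer with $v>n$. Write $v=qn+r$ with integers $q$ and $0\le r<n$. Then \[ N(G,n)\le \left\lfloor \frac{\binom{v}{2}-e}{(n-r)\binom{\lfloor v/n\rfloor}{2}+r\binom{\lceil v/n\rceil}{2}}\right\rfloor. \]
   Context: All graphs are finite simple graphs. An $n$-coloring of a graph $G$ is a proper vertex coloring using at most $n$ colors. Two colorings $C_1,C_2$ of $G$ are orthogonal if whenever two distinct vertices share a color in $C_1$, they have distinct colors in $C_2$. $N(G,n)$ denotes the maximum size of a set of pairwise orthogonal $n$-colorings of $G$. *)

theory Defs
  imports Complex_Main "HOL-Library.FuncSet"
begin

definition simple_graph :: "'a set \<Rightarrow> 'a set set \<Rightarrow> bool" where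
  "simple_graph V E \<longleftrightarrow> finite V \<and> (\<forall>u\<in>E. u \<subseteq> V \<and> card u = 2)"

text \<open>The colors are \<open>0, \<dots>, n - 1\<close>, and not all of them need occur. A coloring is
  extensional (\<open>undefined\<close> outside \<open>V\<close>), so two colorings are equal iff they agree on \<open>V\<close>.\<close>
definition colorings :: "'a set \<Rightarrow> 'a set set \<Rightarrow> nat \<Rightarrow> ('a \<Rightarrow> nat) set" where
  "colorings V E n =
     {c \<in> V \<rightarrow>\<^sub>E {..<n}. \<forall>x\<in>V. \<forall>y\<in>V. {x, y} \<in> E \<longrightarrow> c x \<noteq> c y}"

definition orthogonal_colorings :: "'a set \<Rightarrow> ('a \<Rightarrow> nat) \<Rightarrow> ('a \<Rightarrow> nat) \<Rightarrow> bool" where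
  "orthogonal_colorings V c d \<longleftrightarrow>
     (\<forall>x\<in>V. \<forall>y\<in>V. x \<noteq> y \<and> c x = c y \<longrightarrow> d x \<noteq> d y)"

definition max_orthogonal :: "'a set \<Rightarrow> 'a set set \<Rightarrow> nat \<Rightarrow> nat" where
  "max_orthogonal V E n =
     Max {card S | S. S \<subseteq> colorings V E n \<and> pairwise (orthogonal_colorings V) S}"

text \<open>The maximum is taken over a finite nonempty set, so it is attained; it is \<open>0\<close> if the graph
  has no \<open>n\<close>-coloring.\<close>
lemma finite_colorings: "finite V \<Longrightarrow> finite (colorings V E n)"
  unfolding colorings_def by (simp add: finite_PiE)

lemma max_orthogonal_attained:
  assumes "simple_graph V E"
  obtains S where "S \<subseteq> colorings V E n" "pairwise (orthogonal_colorings V) S"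
    "card S = max_orthogonal V E n"
proof -
  let ?A = "{card S | S. S \<subseteq> colorings V E n \<and> pairwise (orthogonal_colorings V) S}"
  have "finite (Pow (colorings V E n))"
    using assms by (simp add: simple_graph_def finite_colorings)
  moreover have "?A \<subseteq> card ` Pow (colorings V E n)" by auto
  ultimately have "finite ?A" by (meson finite_imageI finite_subset)
  moreover have "card {} \<in> ?A" by (intro CollectI exI[of _ "{}"]) simp
  ultimately have "Max ?A \<in> ?A" by (metis (lifting) Max_in empty_iff)
  then show thesis using that unfolding max_orthogonal_def by auto
qed

end

theory Submission
  imports Defs
begin

text \<open>Each \<open>n\<close>-coloring has at least as many monochromatic pairs of vertices as an equitable
  partition of \<open>V\<close> into \<open>n\<close> classes. Monochromatic pairs are never edges, and orthogonal colorings
  have disjoint sets of monochromatic pairs, so at most \<open>(v choose 2) - e\<close> pairs are available.\<close>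

text \<open>Unordered pairs are two-element sets, just as edges are, so these sets can be compared
  directly with \<open>E\<close> and with each other.\<close>

definition mono_pairs :: "'a set \<Rightarrow> ('a \<Rightarrow> 'b) \<Rightarrow> 'a set set" where
  "mono_pairs V c = {{x, y} | x y. x \<in> V \<and> y \<in> V \<and> x \<noteq> y \<and> c x = c y}"

lemma real_choose_two: "real (k choose 2) = real k * (real k - 1) / 2"
  by (induction k) (auto simp: numeral_2_eq_2 field_simps)

text \<open>The difference of the two sides is \<open>(k - m) (k - m - 1) / 2\<close>, which is nonnegative because
  \<open>k - m\<close> is an integer.\<close>
lemma choose_two_ge_linear:
  fixes m :: int
  shows "real (k choose 2) \<ge> real_of_int m * real k - real_of_int m * (real_of_int m + 1) / 2"
proof -
  have "0 \<le> (int k - m) * (int k - m - 1)"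
    by (cases "int k \<le> m") (auto intro: mult_nonpos_nonpos)
  then have "0 \<le> real_of_int ((int k - m) * (int k - m - 1))"
    by (simp only: of_int_0_le_iff)
  then show ?thesis
    by (simp add: real_choose_two field_simps)
qed

text \<open>A monochromatic pair is a 2-subset of exactly one color class. Colors in
  \<open>I\<close> that do not occur contribute \<open>0 choose 2 = 0\<close>, so \<open>I\<close>
  can later be the full set of \<open>n\<close> colors.\<close>

lemma card_mono_pairs:
  assumes "finite V" "finite I" "c ` V \<subseteq> I"
  shows "card (mono_pairs V c) = (\<Sum>i\<in>I. card {x \<in> V. c x = i} choose 2)"
proof -
  let ?P = "\<lambda>i. {s. s \<subseteq> {x \<in> V. c x = i} \<and> card s = 2}"
  have eq: "mono_pairs V c = (\<Union>i\<in>I. ?P i)"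
  proof (intro equalityI subsetI)
    fix s assume "s \<in> mono_pairs V c"
    then obtain x y where "s = {x, y}" "x \<in> V" "y \<in> V" "x \<noteq> y" "c x = c y"
      unfolding mono_pairs_def by blast
    then have "s \<in> ?P (c x)" "c x \<in> I"
      using assms(3) by auto
    then show "s \<in> (\<Union>i\<in>I. ?P i)"
      by blast
  next
    fix s assume "s \<in> (\<Union>i\<in>I. ?P i)"
    then obtain i x y where "s = {x, y}" "x \<noteq> y" "{x, y} \<subseteq> {x \<in> V. c x = i}"
      unfolding card_2_iff by blast
    then show "s \<in> mono_pairs V c"
      unfolding mono_pairs_def by blast
  qed
  have "card (\<Union>i\<in>I. ?P i) = (\<Sum>i\<in>I. card (?P i))"
  proof (rule card_UN_disjoint)
    show "\<forall>i\<in>I. finite (?P i)"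
      using assms(1) by auto
    have False if *: "i \<noteq> j" "s \<in> ?P i" "s \<in> ?P j" for i j s
    proof -
      obtain x where "x \<in> s"
        using *(2) by force
      with * show False
        by auto
    qed
    then show "\<forall>i\<in>I. \<forall>j\<in>I. i \<noteq> j \<longrightarrow> ?P i \<inter> ?P j = {}"
      by blast
  qed (use assms in auto)
  also have "\<dots> = (\<Sum>i\<in>I. card {x \<in> V. c x = i} choose 2)"
    using assms(1) by (intro sum.cong refl n_subsets) auto
  finally show ?thesis
    by (simp add: eq)
qed

text \<open>Each class size k satisfies \<open>choose_two_ge_linear\<close> with m = q, whose line
  meets k choose 2 at k = q and k = q + 1. The class sizes have sum \<open>card V\<close>, so adding
  these linear bounds gives a value that no longer depends on the coloring.\<close>

lemma card_mono_pairs_ge: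
  fixes q r :: int
  assumes "finite V" "finite I" "c ` V \<subseteq> I" "int (card V) = q * int (card I) + r"
  shows "real (card (mono_pairs V c)) \<ge>
    real (card I) * (real_of_int q * (real_of_int q - 1) / 2) + real_of_int r * real_of_int q"
proof -
  have "card V = (\<Sum>i\<in>I. card {x \<in> V. c x = i})"
    using sum.group[OF assms(1-3), of "\<lambda>_. 1 :: nat"] by simp
  then have v: "(\<Sum>i\<in>I. real (card {x \<in> V. c x = i})) = real (card V)"
    by simp
  have "real_of_int (int (card V)) = real_of_int (q * int (card I) + r)"
    using assms(4) by simp
  \<comment> \<open>Substituting \<open>card V\<close> = q * \<open>card I\<close> + r turns the
    claimed bound into the sum of the linear bounds.\<close>
  then have "real (card I) * (real_of_int q * (real_of_int q - 1) / 2) + real_of_int r * real_of_int q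
      = real_of_int q * real (card V) - real (card I) * (real_of_int q * (real_of_int q + 1) / 2)"
    by (simp add: field_simps)
  also have "\<dots> = (\<Sum>i\<in>I. real_of_int q * real (card {x \<in> V. c x = i})
      - real_of_int q * (real_of_int q + 1) / 2)"
    by (simp add: sum_subtractf v flip: sum_distrib_left)
  also have "\<dots> \<le> (\<Sum>i\<in>I. real (card {x \<in> V. c x = i} choose 2))"
    by (intro sum_mono choose_two_ge_linear)
  also have "\<dots> = real (card (mono_pairs V c))"
    by (simp add: card_mono_pairs[OF assms(1-3)])
  finally show ?thesis .
qed

lemma mono_pairs_disjoint:
  assumes "orthogonal_colorings V c d"
  shows "mono_pairs V c \<inter> mono_pairs V d = {}"
  using assms unfolding mono_pairs_def orthogonal_colorings_def
  by (auto simp: doubleton_eq_iff)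

lemma mono_pairs_disjoint_edges:
  assumes "c \<in> colorings V E n"
  shows "mono_pairs V c \<inter> E = {}"
  using assms unfolding mono_pairs_def colorings_def by auto

lemma sum_card_mono_pairs_le:
  assumes G: "simple_graph V E"
    and S: "S \<subseteq> colorings V E n" "pairwise (orthogonal_colorings V) S"
  shows "(\<Sum>c\<in>S. card (mono_pairs V c)) + card E \<le> card V choose 2"
proof -
  let ?U = "\<Union>c\<in>S. mono_pairs V c"
  let ?P = "{s. s \<subseteq> V \<and> card s = 2}"
  have V: "finite V" and E: "E \<subseteq> ?P"
    using G unfolding simple_graph_def by auto
  have P: "finite ?P"
    using V by auto
  have sub: "mono_pairs V c \<subseteq> ?P" for c :: "'a \<Rightarrow> nat"
    unfolding mono_pairs_def by auto
  have "(\<Sum>c\<in>S. card (mono_pairs V c)) = card ?U"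
  proof (rule card_UN_disjoint[symmetric])
    show "finite S"
      using S(1) V by (metis finite_colorings finite_subset)
    show "\<forall>c\<in>S. finite (mono_pairs V c)"
      using P sub by (meson finite_subset)
    show "\<forall>c\<in>S. \<forall>d\<in>S. c \<noteq> d \<longrightarrow> mono_pairs V c \<inter> mono_pairs V d = {}"
      using S(2) mono_pairs_disjoint unfolding pairwise_def by blast
  qed
  also have "card ?U + card E = card (?U \<union> E)"
  proof (rule card_Un_disjoint[symmetric])
    show "finite ?U"
      by (rule finite_subset[OF _ P]) (use sub in blast)
    show "finite E"
      by (rule finite_subset[OF E P])
    show "?U \<inter> E = {}"
      using mono_pairs_disjoint_edges S(1) by blast
  qed
  also have "\<dots> \<le> card ?P"
    by (rule card_mono[OF P]) (use sub E in blast)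
  also have "\<dots> = card V choose 2"
    by (rule n_subsets[OF V])
  finally show ?thesis
    by simp
qed

text \<open>If \<open>r = 0\<close> the ceiling is \<open>q\<close> rather than \<open>q + 1\<close>, but its coefficient vanishes.\<close>
lemma equitable_mono_pairs:
  fixes v n :: nat and q r :: int
  assumes "n > 0" "int v = q * int n + r" "0 \<le> r" "r < int n"
  shows "(real n - real_of_int r) * real (nat \<lfloor>real v / real n\<rfloor> choose 2)
      + real_of_int r * real (nat \<lceil>real v / real n\<rceil> choose 2)
    = real n * (real_of_int q * (real_of_int q - 1) / 2) + real_of_int r * real_of_int q"
proof -
  have "real_of_int (int v) = real_of_int (q * int n + r)"
    using assms(2) by simp
  then have d: "real v / real n = real_of_int q + real_of_int r / real n"
    using assms(1) by (simp add: field_simps)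
  have r: "0 \<le> real_of_int r / real n" "real_of_int r / real n < 1"
    using assms(1,3,4) by auto
  \<comment> \<open>A nonnegative quotient with fractional part below 1 forces q > -1, so the
    integer q is nonnegative and \<open>nat\<close> leaves it unchanged.\<close>
  have "0 \<le> real_of_int q + real_of_int r / real n"
    by (simp flip: d)
  then have q: "0 \<le> q"
    using r by linarith
  have fl: "\<lfloor>real v / real n\<rfloor> = q"
    unfolding d using r by (intro floor_unique) auto
  show ?thesis
  proof (cases "r = 0")
    case True
    then show ?thesis
      using q by (simp add: fl real_choose_two)
  next
    case False
    then have "0 < real_of_int r / real n"
      using assms(1,3) by simp
    then have "\<lceil>real v / real n\<rceil> = q + 1"
      unfolding d using r by (intro ceiling_unique) auto
    \<comment> \<open>By Pascal's rule (q + 1) choose 2 exceeds q choose 2 by q, and this happens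
      for r of the n classes.\<close>
    then show ?thesis
      using q by (simp add: fl real_choose_two field_simps)
  qed
qed

theorem theorem1p4:
  fixes V :: "'a set" and E :: "'a set set" and v e n :: nat and q r :: int
  assumes "simple_graph V E"
    and "card V = v" and "card E = e"
    and "n > 0" and "v > n"
    and "int v = q * int n + r" and "0 \<le> r" and "r < int n"
  shows "int (max_orthogonal V E n) \<le>
    \<lfloor>(real (v choose 2) - real e) /
      ((real n - real_of_int r) * real (nat \<lfloor>real v / real n\<rfloor> choose 2)
        + real_of_int r * real (nat \<lceil>real v / real n\<rceil> choose 2))\<rfloor>"
proof -
  \<comment> \<open>\<open>D\<close> is the denominator of the bound in the closed form of
    \<open>equitable_mono_pairs\<close>.\<close>
  define D where
    "D = real n * (real_of_int q * (real_of_int q - 1) / 2) + real_of_int r * real_of_int q"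
  have "q > 0"
  proof (rule ccontr)
    assume "\<not> q > 0"
    then have "q * int n \<le> 0"
      by (simp add: mult_nonpos_nonneg)
    then show False
      using assms(5,6,8) by linarith
  qed
  have "D > 0"
  \<comment> \<open>For q = 1 the first summand of \<open>D\<close> vanishes and \<open>D\<close> =
    r = v - n, which is positive since v > n is strict. For q > 1 the first summand is already
    positive.\<close>
  proof (cases "q = 1")
    case True
    then show ?thesis
      using assms(5,6) by (simp add: D_def)
  next
    case False
    with \<open>q > 0\<close> have "real_of_int q * (real_of_int q - 1) > 0"
      by simp
    then show ?thesis
      using assms(4,7) \<open>q > 0\<close> unfolding D_def by (intro add_pos_nonneg mult_pos_pos) auto
  qed
  obtain S where S: "S \<subseteq> colorings V E n" "pairwise (orthogonal_colorings V) S"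
    and card_S: "card S = max_orthogonal V E n"
    using max_orthogonal_attained[OF assms(1)] .
  have ge: "D \<le> real (card (mono_pairs V c))" if "c \<in> S" for c
  proof -
    have "c ` V \<subseteq> {..<n}"
      using that S(1) unfolding colorings_def by auto
    moreover have "finite V"
      using assms(1) unfolding simple_graph_def by simp
    ultimately show ?thesis
      using card_mono_pairs_ge[of V "{..<n}" c q r] assms(2,6) by (simp add: D_def)
  qed
  \<comment> \<open>Double counting: every coloring in \<open>S\<close> takes up at least
    \<open>D\<close> of the non-adjacent pairs, and none of them is taken twice.\<close>
  have "real (card S) * D \<le> (\<Sum>c\<in>S. real (card (mono_pairs V c)))"
    by (rule sum_bounded_below) (rule ge)
  also have "\<dots> \<le> real (v choose 2) - real e"
    using sum_card_mono_pairs_le[OF assms(1) S] assms(2,3)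
    by (simp add: le_diff_eq flip: of_nat_sum of_nat_add)
  finally have "real (card S) \<le> (real (v choose 2) - real e) / D"
    using \<open>D > 0\<close> by (simp add: pos_le_divide_eq)
  then show ?thesis
    unfolding equitable_mono_pairs[OF assms(4,6-8)] D_def[symmetric]
    by (simp add: le_floor_iff card_S)
qed

end
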